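(* Let $\mathrm{d}$ be a diffuse Fredholm-nilpotent operator on a real Hilbert space $W$ with dense domain $V$, and let $V_h\subset V$ be a family of closed subspaces, parametrized by $h$, with $\mathrm{d}V_h\subset V_h$, equipped with projections $\pi_h$ onto $V_h$ that are defined and bounded on $W$, uniformly in $h$, and satisfy $\pi_h\mathrm{d}=\mathrm{d}\pi_h$ on $V$. Then there is a constant $C>0$, independent of $h$ and $f$, such that for every $f\in W$ and every $h$: if $(u,p)\in V\times\mathfrak{H}$ solves $$\langle \mathrm{d}u,v\rangle+\langle u,\mathrm{d}v\rangle+\langle p,v\rangle=\langle f,v\rangle\ \ \forall v\in V,\qquad \langle u,q\rangle=0\ \ \forall q\in\mathfrak{H},$$ and $(u_h,p_h)\in V_h\times\mathfrak{H}_h$ solves $$\langle \mathrm{d}u_h,v_h\rangle+\langle u_h,\mathrm{d}v_h\rangle+\langle p_h,v_h\rangle=\langle f,v_h\rangle\ \ \forall v_h\in V_h,\qquad \langle u_h,q_h\rangle=0\ \ \forall q_h\in\mathfrak{H}_h,$$ then $$\|P_{\mathfrak{B}}u-P_{\mathfrak{B}_h}u_h\|\le C\Bigl(E(P_{\mathfrak{B}}u)+\eta\bigl[E(\mathrm{d}u)+E(p)\bigr]\Bigr),$$ where $\eta=\|(I-\pi_h)K\|$.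
   Context: $W$ has inner product $\langle\cdot,\cdot\rangle$ and norm $\|\cdot\|$. A closed, densely defined linear operator $\mathrm{d}$ on $W$ with domain $V=\mathcal{D}(\mathrm{d})$ is nilpotent if its range is contained in its kernel (so $\mathrm{d}^2=0$); it is diffuse Fredholm-nilpotent if in addition its range is closed, its range has finite codimension in its kernel, and $\mathcal{D}(\mathrm{d})\cap\ker(\mathrm{d})^\perp$ (with the graph norm) is compactly included in $\ker(\mathrm{d})^\perp$. $V$ carries the graph inner product $\langle u,v\rangle_V=\langle u,v\rangle+\langle \mathrm{d}u,\mathrm{d}v\rangle$. Set $\mathfrak{Z}=\ker\mathrm{d}$, $\mathfrak{B}=\operatorname{range}\mathrm{d}$, $\mathfrak{H}=\mathfrak{Z}\cap\mathfrak{B}^{\perp_W}$, where $\perp_W$ is the orthogonal complement in $W$. "Projection $\pi_h$ onto $V_h$" means linear, idempotent, with range $V_h$ (not necessarily orthogonal). For $\mathrm{d}_h=\mathrm{d}|_{V_h}$ put $\mathfrak{Z}_h=\ker\mathrm{d}_h$, $\mathfrak{B}_h=\mathrm{d}V_h$, $\mathfrak{H}_h=\{z\in\mathfrak{Z}_h:\langle z,b\rangle=0\ \forall b\in\mathfrak{B}_h\}$. $P_X$ denotes $W$-orthogonal projection onto a closed subspace $X$. $K\colon W\to W$ is the solution operator $f\mapsto u$, where $(u,p)\in V\times\mathfrak{H}$ is the unique solution of the first (continuous) variational problem in the claim with right-hand side $f$. $\eta$ (which depends on $h$) is an operator norm on $W$. For $w\in W$, $E(w)=\inf_{v_h\in V_h}\|w-v_h\|$.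 *)

theory Defs
  imports "HOL-Analysis.Analysis"
begin

(* An unbounded operator on W is a pair (V, d): the domain V and a total function d of which only
   the values on V are meaningful.  The restriction of d to a subspace V' of V is the pair (V', d). *)

definition linear_operator :: "'a::real_vector set \<Rightarrow> ('a \<Rightarrow> 'a) \<Rightarrow> bool" where
  "linear_operator V d \<longleftrightarrow> subspace V \<and>
     (\<forall>u\<in>V. \<forall>v\<in>V. d (u + v) = d u + d v) \<and>
     (\<forall>c. \<forall>u\<in>V. d (c *\<^sub>R u) = c *\<^sub>R d u)"

(* The norm of the product type is  norm (x, y) = sqrt ((norm x)^2 + (norm y)^2),  so u |-> (u, d u)
   is an isometry from V with the graph norm onto the graph.  Topological statements about the graph
   norm are expressed below through this map. *)
definition op_graph :: "'a set \<Rightarrow> ('a \<Rightarrow> 'a) \<Rightarrow> ('a \<times> 'a) set" where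
  "op_graph S d = (\<lambda>u. (u, d u)) ` S"

definition closed_densely_defined :: "'a::real_normed_vector set \<Rightarrow> ('a \<Rightarrow> 'a) \<Rightarrow> bool" where
  "closed_densely_defined V d \<longleftrightarrow>
     linear_operator V d \<and> closed (op_graph V d) \<and> closure V = UNIV"

definition op_ker :: "'a::zero set \<Rightarrow> ('a \<Rightarrow> 'a) \<Rightarrow> 'a set" where
  "op_ker V d = {u \<in> V. d u = 0}"

definition op_range :: "'a set \<Rightarrow> ('a \<Rightarrow> 'a) \<Rightarrow> 'a set" where
  "op_range V d = d ` V"

definition harmonic :: "'a::real_inner set \<Rightarrow> ('a \<Rightarrow> 'a) \<Rightarrow> 'a set" where
  "harmonic V d = op_ker V d \<inter> orthogonal_comp (op_range V d)"

definition nilpotent_operator :: "'a::real_normed_vector set \<Rightarrow> ('a \<Rightarrow> 'a) \<Rightarrow> bool" where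
  "nilpotent_operator V d \<longleftrightarrow>
     closed_densely_defined V d \<and> op_range V d \<subseteq> op_ker V d"

(* Last conjunct: sets bounded in the graph norm are relatively compact in the orthogonal complement
   of the kernel; that complement is closed in W, so the closure may be taken in W. *)
definition diffuse_fredholm_nilpotent :: "'a::real_inner set \<Rightarrow> ('a \<Rightarrow> 'a) \<Rightarrow> bool" where
  "diffuse_fredholm_nilpotent V d \<longleftrightarrow>
     nilpotent_operator V d \<and>
     closed (op_range V d) \<and>
     (\<exists>F. finite F \<and> F \<subseteq> op_ker V d \<and> op_ker V d = span (op_range V d \<union> F)) \<and>
     (\<forall>S \<subseteq> V \<inter> orthogonal_comp (op_ker V d). bounded (op_graph S d) \<longrightarrow> compact (closure S))"

definition closed_subspace_graph_norm ::
    "'a::real_normed_vector set \<Rightarrow> ('a \<Rightarrow> 'a) \<Rightarrow> 'a set \<Rightarrow> bool" where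
  "closed_subspace_graph_norm V d U \<longleftrightarrow>
     subspace U \<and> U \<subseteq> V \<and> closedin (top_of_set (op_graph V d)) (op_graph U d)"

definition projection_onto :: "('a::real_vector \<Rightarrow> 'a) \<Rightarrow> 'a set \<Rightarrow> bool" where
  "projection_onto \<pi> U \<longleftrightarrow> linear \<pi> \<and> (\<forall>w. \<pi> (\<pi> w) = \<pi> w) \<and> range \<pi> = U"

(* Meaningful for closed subspaces X of a Hilbert space. *)
definition orth_proj :: "'a::real_inner set \<Rightarrow> 'a \<Rightarrow> 'a" where
  "orth_proj X w = (THE x. x \<in> X \<and> w - x \<in> orthogonal_comp X)"

(* With U = V this is the continuous problem, with U = V_h the discrete one. *)
definition solves_problem ::
    "'a::real_inner set \<Rightarrow> ('a \<Rightarrow> 'a) \<Rightarrow> 'a \<Rightarrow> 'a \<Rightarrow> 'a \<Rightarrow> bool" where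
  "solves_problem U d f u p \<longleftrightarrow> u \<in> U \<and> p \<in> harmonic U d \<and>
     (\<forall>v\<in>U. d u \<bullet> v + u \<bullet> d v + p \<bullet> v = f \<bullet> v) \<and>
     (\<forall>q\<in>harmonic U d. u \<bullet> q = 0)"

definition solution_operator :: "'a::real_inner set \<Rightarrow> ('a \<Rightarrow> 'a) \<Rightarrow> 'a \<Rightarrow> 'a" where
  "solution_operator V d f = (THE u. \<exists>p. solves_problem V d f u p)"

definition best_approx_error :: "'a::real_normed_vector set \<Rightarrow> 'a \<Rightarrow> real" where
  "best_approx_error U w = (INF v\<in>U. norm (w - v))"

end

theory Submission
  imports Defs
begin

text \<open>
  Write b = P_B u, let P be the orthogonal projection onto B_h = d V_h, and put e = P b - P u_h
  and w = K e.  Then w is orthogonal to ker d and d w = e, so that e = \<pi>_h d w = d (\<pi>_h w).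
  Testing both problems with \<pi>_h w gives |e|^2 = g . (w - \<pi>_h w) for
  g = (d u + p) - (d u_h + p_h), because g lies in ker d and is thus orthogonal to w; hence
  |e| \<le> \<eta> |g|.  Moreover d u_h + p_h is the orthogonal projection of d u + p onto ker d_h, so
  |g| is at most the error of \<pi>_h at d u + p, and likewise |b - P b| is at most the error of
  \<pi>_h at b.  That K is bounded, which is needed for \<eta> to be an upper bound, follows from the
  Poincare inequality supplied by compactness.
\<close>

section \<open>Orthogonal projection in a Hilbert space and the Riesz theorem\<close>

text \<open>A minimizing sequence for the distance from \<open>w\<close> to \<open>S\<close> is
  Cauchy by the parallelogram law, and its limit \<open>x\<close> is a nearest point. No shift of
  \<open>x\<close> along \<open>S\<close> comes closer to \<open>w\<close>, which forces
  \<open>w - x\<close> to be orthogonal to \<open>S\<close>.\<close>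

lemma orthogonal_projection_exists:
  fixes S :: "'a::{real_inner, complete_space} set"
  assumes "closed S" "subspace S"
  shows "\<exists>x\<in>S. w - x \<in> orthogonal_comp S"
proof -
  define D where "D = (INF y\<in>S. (norm (w - y))\<^sup>2)"
  have ne: "S \<noteq> {}" using subspace_0[OF assms(2)] by auto
  have bdd: "bdd_below ((\<lambda>y. (norm (w - y))\<^sup>2) ` S)" by (rule bdd_belowI[of _ 0]) auto
  have D_le: "D \<le> (norm (w - y))\<^sup>2" if "y \<in> S" for y
    unfolding D_def by (rule cINF_lower[OF bdd that])
  have "\<exists>y\<in>S. (norm (w - y))\<^sup>2 < D + 1 / Suc n" for n
    using cInf_less_iff[OF _ bdd, of "D + 1 / Suc n"] ne unfolding D_def by auto
  then obtain y where yS: "\<And>n. y n \<in> S" and y: "\<And>n. (norm (w - y n))\<^sup>2 < D + 1 / Suc n"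
    by metis
  have dist_le: "(norm (y m - y n))\<^sup>2 \<le> 2 / Suc m + 2 / Suc n" for m n
  proof -
    \<comment> \<open>The midpoint lies in \<open>S\<close>, so its squared distance to
      \<open>w\<close> is at least \<open>D\<close>. The parallelogram law then bounds the gap by
      twice the two excesses over \<open>D\<close>.\<close>
    have "(1/2) *\<^sub>R (y m + y n) \<in> S"
      using yS assms(2) by (simp add: subspace_add subspace_scale)
    from D_le[OF this] have "4 * D \<le> 4 * (norm (w - (1/2) *\<^sub>R (y m + y n)))\<^sup>2" by simp
    also have "\<dots> = 2 * (norm (w - y m))\<^sup>2 + 2 * (norm (w - y n))\<^sup>2 - (norm (y m - y n))\<^sup>2"
      by (simp add: power2_norm_eq_inner algebra_simps inner_commute)
    finally show ?thesis using y[of m] y[of n] by simp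
  qed
  have "Cauchy y"
  proof (rule metric_CauchyI)
    fix e :: real assume "e > 0"
    then obtain N where N: "4 / e\<^sup>2 < real N" using reals_Archimedean2 by blast
    have "dist (y m) (y n) < e" if "m \<ge> N" "n \<ge> N" for m n
    proof -
      have "0 < real N" using N \<open>e > 0\<close> by (meson divide_pos_pos less_trans zero_less_numeral zero_less_power)
      have "2 / Suc m + 2 / Suc n \<le> 2 / real N + 2 / real N"
        using that \<open>0 < real N\<close> by (intro add_mono divide_left_mono) auto
      also have "\<dots> < e\<^sup>2" using N \<open>e > 0\<close> \<open>0 < real N\<close> by (simp add: field_simps)
      finally have "(norm (y m - y n))\<^sup>2 < e\<^sup>2" using dist_le[of m n] by simp
      then show ?thesis using \<open>e > 0\<close> by (simp add: dist_norm power_less_imp_less_base)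
    qed
    then show "\<exists>N. \<forall>m\<ge>N. \<forall>n\<ge>N. dist (y m) (y n) < e" by blast
  qed
  then obtain x where x: "y \<longlonglongrightarrow> x" by (auto simp: Cauchy_convergent_iff convergent_def)
  have xS: "x \<in> S" using closed_sequentially[OF assms(1)] yS x by blast
  have lim_w: "(\<lambda>n. (norm (w - y n))\<^sup>2) \<longlonglongrightarrow> (norm (w - x))\<^sup>2"
    by (intro tendsto_intros x)
  have lim_D: "(\<lambda>n. D + 1 / Suc n) \<longlonglongrightarrow> D + 0"
    by (intro tendsto_intros LIMSEQ_Suc[OF lim_1_over_n])
  have x_le: "(norm (w - x))\<^sup>2 \<le> D"
    by (rule LIMSEQ_le[OF lim_w lim_D[unfolded add_0_right]]) (use y less_imp_le in blast)
  have "(w - x) \<bullet> z = 0" if "z \<in> S" for z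
  proof (cases "z = 0")
    case False
    \<comment> \<open>This \<open>t\<close> minimizes the quadratic
      \<open>(norm ((w - x) - t *\<^sub>R z))\<^sup>2\<close>; its minimum lies below the value at 0
      by \<open>((w - x) \<bullet> z)\<^sup>2 / (z \<bullet> z)\<close>, which minimality of
      \<open>x\<close> makes nonpositive.\<close>
    define t where "t = ((w - x) \<bullet> z) / (z \<bullet> z)"
    have "x + t *\<^sub>R z \<in> S" using xS that assms(2) by (simp add: subspace_add subspace_scale)
    then have "(norm (w - x))\<^sup>2 \<le> (norm ((w - x) - t *\<^sub>R z))\<^sup>2"
      using order_trans[OF x_le D_le] by (simp only: diff_diff_eq)
    also have "\<dots> = (norm (w - x))\<^sup>2 - 2 * t * ((w - x) \<bullet> z) + t * (t * (z \<bullet> z))"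
      unfolding power2_norm_eq_inner
      by (simp only: inner_diff_left inner_diff_right inner_scaleR_left inner_scaleR_right)
         (simp add: algebra_simps inner_commute)
    also have "t * (z \<bullet> z) = (w - x) \<bullet> z" using False by (simp add: t_def)
    finally have "t * ((w - x) \<bullet> z) \<le> 0" by simp
    then have "((w - x) \<bullet> z)\<^sup>2 / (z \<bullet> z) \<le> 0" by (simp add: t_def power2_eq_square)
    moreover have "z \<bullet> z > 0" using False by simp
    ultimately have "((w - x) \<bullet> z)\<^sup>2 \<le> 0" by (simp add: divide_le_0_iff)
    then show ?thesis by simp
  qed simp
  then show ?thesis using xS
    by (auto simp: orthogonal_comp_def orthogonal_def inner_commute)
qed

lemma orth_proj_properties:
  fixes S :: "'a::{real_inner, complete_space} set"
  assumes "closed S" "subspace S"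
  shows orth_proj_in: "orth_proj S w \<in> S"
    and orth_proj_orthogonal: "y \<in> S \<Longrightarrow> (w - orth_proj S w) \<bullet> y = 0"
proof -
  have "\<exists>!x. x \<in> S \<and> w - x \<in> orthogonal_comp S"
  proof (rule ex_ex1I)
    show "\<exists>x. x \<in> S \<and> w - x \<in> orthogonal_comp S"
      using orthogonal_projection_exists[OF assms] by blast
  next
    \<comment> \<open>The difference \<open>x - x'\<close> is in \<open>S\<close>, hence orthogonal
      to both residuals and so to their difference, which is \<open>x - x'\<close> itself.\<close>
    fix x x' assume a: "x \<in> S \<and> w - x \<in> orthogonal_comp S" "x' \<in> S \<and> w - x' \<in> orthogonal_comp S"
    then have "x - x' \<in> S" using assms(2) by (simp add: subspace_diff)
    with a have "(x - x') \<bullet> (w - x) = 0" "(x - x') \<bullet> (w - x') = 0"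
      by (auto simp: orthogonal_comp_def orthogonal_def)
    then have "(x - x') \<bullet> (x - x') = 0" by (simp add: inner_diff_right)
    then show "x = x'" by simp
  qed
  from theI'[OF this] show "orth_proj S w \<in> S"
    and "y \<in> S \<Longrightarrow> (w - orth_proj S w) \<bullet> y = 0"
    unfolding orth_proj_def[symmetric]
    by (auto simp: orthogonal_comp_def orthogonal_def inner_commute)
qed

text \<open>Since \<open>w - x\<close> is orthogonal to \<open>x - y\<close>, its square equals
  \<open>(w - x) \<bullet> (w - y)\<close>, and Cauchy-Schwarz applies. Stated for any
  \<open>x\<close> with an orthogonal residual, it also covers a projection known only through
  variational equations.\<close>

lemma norm_diff_le_of_orthogonal:
  fixes w :: "'a::real_inner"
  assumes "subspace S" "x \<in> S" "y \<in> S" and orth: "\<And>z. z \<in> S \<Longrightarrow> (w - x) \<bullet> z = 0"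
  shows "norm (w - x) \<le> norm (w - y)"
proof -
  have "(w - x) \<bullet> (w - x) = (w - x) \<bullet> (w - y)"
    using orth[of "x - y"] assms(1-3) by (simp add: subspace_diff inner_diff_right)
  then have "(norm (w - x))\<^sup>2 \<le> norm (w - x) * norm (w - y)"
    by (metis norm_cauchy_schwarz power2_norm_eq_inner)
  then show ?thesis
    by (cases "norm (w - x) = 0") (auto simp: power2_eq_square)
qed

lemma orth_proj_linear:
  fixes S :: "'a::{real_inner, complete_space} set"
  assumes "closed S" "subspace S"
  shows "linear (orth_proj S)"
proof -
  \<comment> \<open>Orthogonality of the residual characterizes the projection, so linearity reduces
    to checking it for the expected right-hand sides.\<close>
  have eq: "orth_proj S w = x" if "x \<in> S" "\<And>y. y \<in> S \<Longrightarrow> (w - x) \<bullet> y = 0" for w x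
  proof -
    let ?e = "orth_proj S w - x"
    have "?e \<in> S" using that orth_proj_in[OF assms] assms(2) by (simp add: subspace_diff)
    then have "(w - x) \<bullet> ?e = 0" "(w - orth_proj S w) \<bullet> ?e = 0"
      using that orth_proj_orthogonal[OF assms] by auto
    then have "?e \<bullet> ?e = 0" by (simp add: inner_diff_left)
    then show ?thesis by simp
  qed
  note o = orth_proj_orthogonal[OF assms, unfolded inner_diff_left]
  show ?thesis
  proof (rule linearI)
    show "orth_proj S (a + b) = orth_proj S a + orth_proj S b" for a b
      using o[of _ a] o[of _ b] orth_proj_in[OF assms] assms(2)
      by (intro eq) (auto simp: subspace_add inner_diff_left inner_add_left)
    show "orth_proj S (c *\<^sub>R a) = c *\<^sub>R orth_proj S a" for a c
      using o[of _ a] orth_proj_in[OF assms] assms(2)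
      by (intro eq) (auto simp: subspace_scale inner_diff_left)
  qed
qed

lemma norm_orth_proj_le:
  fixes S :: "'a::{real_inner, complete_space} set"
  assumes "closed S" "subspace S"
  shows "norm (orth_proj S w) \<le> norm w"
proof -
  let ?x = "orth_proj S w"
  have "?x \<bullet> ?x = w \<bullet> ?x"
    using orth_proj_orthogonal[OF assms orth_proj_in[OF assms, of w], of w] by (simp add: inner_diff_left)
  then have "(norm ?x)\<^sup>2 \<le> norm w * norm ?x"
    by (metis norm_cauchy_schwarz power2_norm_eq_inner)
  then show ?thesis
    by (cases "norm ?x = 0") (auto simp: power2_eq_square)
qed

text \<open>The kernel of a nonzero functional has a one-dimensional orthogonal complement. The
  component \<open>?z\<close> of \<open>x0\<close> orthogonal to the kernel spans it, and a multiple
  of \<open>?z\<close> represents the functional.\<close>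

lemma Riesz_representation:
  fixes \<phi> :: "'a::{real_inner, complete_space} \<Rightarrow> real"
  assumes "bounded_linear \<phi>"
  obtains r where "\<And>x. \<phi> x = r \<bullet> x"
proof (cases "\<forall>x. \<phi> x = 0")
  case True
  then show ?thesis using that[of 0] by simp
next
  case False
  then obtain x0 where x0: "\<phi> x0 \<noteq> 0" by blast
  interpret bounded_linear \<phi> by fact
  let ?N = "{x. \<phi> x = 0}"
  have N: "closed ?N" "subspace ?N"
    by (auto intro!: closed_Collect_eq continuous_intros continuous_on simp: subspace_def add scaleR zero)
  let ?z = "x0 - orth_proj ?N x0"
  have z: "\<phi> ?z = \<phi> x0" using orth_proj_in[OF N, of x0] by (simp add: diff)
  then have zz: "?z \<bullet> ?z \<noteq> 0" using x0 by (metis inner_eq_zero_iff zero)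
  show ?thesis
  proof (rule that)
    fix x
    have "\<phi> (x - (\<phi> x / \<phi> x0) *\<^sub>R ?z) = 0" using z x0 by (simp only: diff scaleR z) simp
    then have "?z \<bullet> (x - (\<phi> x / \<phi> x0) *\<^sub>R ?z) = 0"
      using orth_proj_orthogonal[OF N, of _ x0] by blast
    then have "?z \<bullet> x = (\<phi> x / \<phi> x0) * (?z \<bullet> ?z)"
      by (simp only: inner_diff_right[of ?z x] inner_scaleR_right)
    then show "\<phi> x = ((\<phi> x0 / (?z \<bullet> ?z)) *\<^sub>R ?z) \<bullet> x"
      using zz x0 by (simp only: inner_scaleR_left) (simp add: field_simps)
  qed
qed

section \<open>Quasi-optimality of bounded projections\<close>

text \<open>The map \<open>w \<mapsto> w - \<pi> w\<close> kills \<open>U\<close>, so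
  \<open>w\<close> may be replaced by \<open>w - v\<close> for every \<open>v\<close> in
  \<open>U\<close> before the norm bound is used; then pass to the infimum over
  \<open>v\<close>.\<close>

lemma norm_diff_projection_le:
  assumes "projection_onto \<pi> U" and M: "\<And>w. norm (\<pi> w) \<le> M * norm w" "M \<ge> 0"
  shows "norm (w - \<pi> w) \<le> (1 + M) * best_approx_error U w"
proof -
  have lin: "linear \<pi>" and U: "range \<pi> = U" and idem: "\<And>v. v \<in> U \<Longrightarrow> \<pi> v = v"
    using assms(1) by (auto simp: projection_onto_def)
  have "norm (w - \<pi> w) / (1 + M) \<le> norm (w - v)" if "v \<in> U" for v
  proof -
    have "w - \<pi> w = (w - v) - \<pi> (w - v)"
      using idem[OF that] by (simp add: linear_diff[OF lin])
    then have "norm (w - \<pi> w) \<le> norm (w - v) + M * norm (w - v)"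
      by (metis M(1) add_left_mono norm_triangle_ineq4 order_trans)
    then show ?thesis using M(2) by (simp add: field_simps)
  qed
  then have "norm (w - \<pi> w) / (1 + M) \<le> best_approx_error U w"
    unfolding best_approx_error_def using U by (intro cINF_greatest) auto
  then show ?thesis using M(2) by (simp add: field_simps)
qed


section \<open>Kernel, range and harmonic space of the operator\<close>

locale diffuse_operator =
  fixes V :: "'a::{real_inner, complete_space} set" and d :: "'a \<Rightarrow> 'a"
  assumes diffuse: "diffuse_fredholm_nilpotent V d"
begin

abbreviation "Z \<equiv> op_ker V d"
abbreviation "B \<equiv> op_range V d"

lemma nilpotent: "nilpotent_operator V d"
  using diffuse by (simp add: diffuse_fredholm_nilpotent_def)

lemma subspace_V: "subspace V"
  and d_add: "u \<in> V \<Longrightarrow> v \<in> V \<Longrightarrow> d (u + v) = d u + d v"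
  and d_scale: "u \<in> V \<Longrightarrow> d (c *\<^sub>R u) = c *\<^sub>R d u"
  and closed_graph: "closed (op_graph V d)"
  using nilpotent by (auto simp: nilpotent_operator_def closed_densely_defined_def linear_operator_def)

lemma d_zero [simp]: "d 0 = 0"
  using d_scale[OF subspace_0[OF subspace_V], of 0] by simp

lemma d_diff: "u \<in> V \<Longrightarrow> v \<in> V \<Longrightarrow> d (u - v) = d u - d v"
  using d_add[of u "(-1) *\<^sub>R v"] d_scale[of v "-1"] subspace_scale[OF subspace_V, of v "-1"] by simp

lemma in_B [intro]: "v \<in> V \<Longrightarrow> d v \<in> B"
  by (simp add: op_range_def)

lemma B_subset_Z: "B \<subseteq> Z"
  using nilpotent by (simp add: nilpotent_operator_def)

lemma Z_iff: "z \<in> Z \<longleftrightarrow> z \<in> V \<and> d z = 0"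
  by (simp add: op_ker_def)

lemma closed_B: "closed B"
  using diffuse by (simp add: diffuse_fredholm_nilpotent_def)

lemma subspace_image: "subspace U \<Longrightarrow> U \<subseteq> V \<Longrightarrow> subspace (d ` U)"
  unfolding subspace_def
  by (intro conjI ballI allI; clarsimp; metis (no_types, opaque_lifting) d_add d_scale d_zero image_eqI subsetD)

lemma subspace_B: "subspace B"
  using subspace_image[OF subspace_V] by (simp add: op_range_def)

lemma subspace_Z: "subspace Z"
  using subspace_V by (auto simp: subspace_def Z_iff d_add d_scale)

text \<open>As \<open>d\<close> may be unbounded, closedness comes from the graph: the kernel is its
  preimage under the continuous map \<open>u \<mapsto> (u, 0)\<close>.\<close>

lemma closed_Z: "closed Z"
proof -
  have "Z = (\<lambda>u. (u, 0)) -` op_graph V d"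
    by (auto simp: op_graph_def Z_iff)
  then show ?thesis
    using closed_graph by (simp add: closed_vimage continuous_on_Pair)
qed

lemma harmonic_iff: "p \<in> harmonic V d \<longleftrightarrow> p \<in> Z \<and> (\<forall>v\<in>V. p \<bullet> d v = 0)"
  by (auto simp: harmonic_def orthogonal_comp_def orthogonal_def op_range_def inner_commute)

section \<open>The Poincare inequality and bounded potentials\<close>

text \<open>Otherwise there are unit vectors \<open>x n\<close> orthogonal to the kernel with
  \<open>d (x n)\<close> tending to 0. Compactness gives a subsequence with limit \<open>l\<close>,
  and the closed graph puts \<open>l\<close> in the kernel. Then \<open>l\<close> is orthogonal to
  all those \<open>x n\<close>, hence to itself, although it has norm 1.\<close>

lemma Poincare:
  obtains c where "c > 0" "\<And>v. v \<in> V \<Longrightarrow> v \<in> orthogonal_comp Z \<Longrightarrow> norm v \<le> c * norm (d v)"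
proof (rule ccontr)
  assume "\<not> thesis"
  then have "\<exists>v. v \<in> V \<and> v \<in> orthogonal_comp Z \<and> real (Suc n) * norm (d v) < norm v" for n
    using that[of "real (Suc n)"] by (metis not_le of_nat_0_less_iff zero_less_Suc)
  then obtain v where v: "\<And>n. v n \<in> V" "\<And>n. v n \<in> orthogonal_comp Z"
      "\<And>n. real (Suc n) * norm (d (v n)) < norm (v n)"
    by metis
  define x where "x n = (1 / norm (v n)) *\<^sub>R v n" for n
  have pos: "norm (v n) > 0" for n
    using v(3)[of n] by (smt (verit) mult_nonneg_nonneg norm_ge_zero of_nat_0_le_iff)
  have x: "x n \<in> V" "x n \<in> orthogonal_comp Z" "norm (x n) = 1" for n
    using v pos[of n]
    by (auto simp: x_def subspace_scale[OF subspace_V] subspace_scale[OF subspace_orthogonal_comp])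
  have dx: "norm (d (x n)) \<le> 1 / Suc n" for n
    using v(3)[of n] pos[of n] by (simp add: x_def d_scale[OF v(1)] field_simps)
  have "norm (x n, d (x n)) \<le> 1 + 1" for n
  proof -
    have "norm (d (x n)) \<le> 1" using dx[of n] by (rule order_trans) simp
    then show ?thesis using norm_Pair_le[of "x n" "d (x n)"] x(3)[of n] by linarith
  qed
  then have "bounded (op_graph (range x) d)"
    by (auto simp: op_graph_def bounded_iff)
  then have "compact (closure (range x))"
    using diffuse x(1,2) by (simp add: diffuse_fredholm_nilpotent_def image_subset_iff)
  moreover have "\<forall>n. x n \<in> closure (range x)" by (simp add: closure_subset[THEN subsetD])
  ultimately obtain l r where r: "strict_mono (r :: nat \<Rightarrow> nat)" "(x \<circ> r) \<longlonglongrightarrow> l"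
    unfolding compact_def by blast
  have "(\<lambda>n. d (x n)) \<longlonglongrightarrow> 0"
    by (rule Lim_null_comparison[OF _ LIMSEQ_Suc[OF lim_1_over_n]]) (use dx in simp)
  from LIMSEQ_subseq_LIMSEQ[OF this r(1)]
  have "(\<lambda>n. ((x \<circ> r) n, ((\<lambda>n. d (x n)) \<circ> r) n)) \<longlonglongrightarrow> (l, 0)"
    by (intro tendsto_Pair r(2))
  moreover have "((x \<circ> r) n, ((\<lambda>n. d (x n)) \<circ> r) n) \<in> op_graph V d" for n
    using x by (auto simp: op_graph_def)
  ultimately have "(l, 0) \<in> op_graph V d"
    using closed_sequentially[OF closed_graph] by fast
  then have "l \<in> Z" by (auto simp: op_graph_def Z_iff)
  then have "l \<bullet> (x \<circ> r) n = 0" for n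
    using x by (auto simp: orthogonal_comp_def orthogonal_def)
  then have "l \<bullet> l = 0"
    using tendsto_inner[OF tendsto_const r(2), of l] by (simp add: LIMSEQ_const_iff)
  moreover have "norm l = 1"
    using tendsto_norm[OF r(2)] x(3) by (simp add: LIMSEQ_const_iff)
  ultimately show False by simp
qed

text \<open>\<open>T\<close> is the inverse of \<open>d\<close> restricted to the orthogonal
  complement of the kernel, preceded by projection onto the range. Poincare makes this inverse
  single-valued and bounded.\<close>

lemma potential_exists:
  "\<exists>T. bounded_linear T \<and> (\<forall>f. T f \<in> V \<and> T f \<in> orthogonal_comp Z \<and> d (T f) = orth_proj B f)"
proof -
  obtain c where c: "c > 0" "\<And>v. v \<in> V \<Longrightarrow> v \<in> orthogonal_comp Z \<Longrightarrow> norm v \<le> c * norm (d v)"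
    using Poincare by metis
  have "\<exists>s. s \<in> V \<and> s \<in> orthogonal_comp Z \<and> d s = orth_proj B f" for f
  proof -
    obtain v where v: "v \<in> V" "d v = orth_proj B f"
      using orth_proj_in[OF closed_B subspace_B, of f] by (auto simp: op_range_def)
    have z: "orth_proj Z v \<in> V" "d (orth_proj Z v) = 0"
      using orth_proj_in[OF closed_Z subspace_Z] by (auto simp: Z_iff)
    have "v - orth_proj Z v \<in> orthogonal_comp Z"
      using orth_proj_orthogonal[OF closed_Z subspace_Z]
      by (simp add: orthogonal_comp_def orthogonal_def inner_commute)
    with v z show ?thesis
      by (intro exI[of _ "v - orth_proj Z v"]) (simp add: d_diff subspace_diff[OF subspace_V])
  qed
  then obtain T where T: "\<And>f. T f \<in> V" "\<And>f. T f \<in> orthogonal_comp Z" "\<And>f. d (T f) = orth_proj B f"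
    by metis
  interpret P: linear "orth_proj B" by (rule orth_proj_linear[OF closed_B subspace_B])
  \<comment> \<open>By Poincare \<open>d\<close> is injective on this part of \<open>V\<close>, so
    the values of \<open>T\<close>, although chosen pointwise, depend linearly on
    \<open>f\<close>.\<close>
  have eq: "s = t" if "s \<in> V" "s \<in> orthogonal_comp Z" "t \<in> V" "t \<in> orthogonal_comp Z" "d s = d t" for s t
    using c(2)[of "s - t"] that
    by (simp add: d_diff subspace_diff[OF subspace_V] subspace_diff[OF subspace_orthogonal_comp])
  have "bounded_linear T"
  proof (rule bounded_linear_intro[where K = c])
    show "T (a + b) = T a + T b" for a b
      by (rule eq)
        (auto simp: T d_add P.add subspace_add[OF subspace_V] subspace_add[OF subspace_orthogonal_comp])
    show "T (k *\<^sub>R a) = k *\<^sub>R T a" for k a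
      by (rule eq)
        (auto simp: T d_scale P.scale subspace_scale[OF subspace_V] subspace_scale[OF subspace_orthogonal_comp])
    show "norm (T f) \<le> norm f * c" for f
    proof -
      have "norm (T f) \<le> c * norm (orth_proj B f)" using c(2)[OF T(1,2)] T(3) by simp
      also have "\<dots> \<le> c * norm f" using c(1) norm_orth_proj_le[OF closed_B subspace_B] by simp
      finally show ?thesis by (simp add: mult.commute)
    qed
  qed
  with T show ?thesis by blast
qed

section \<open>Well-posedness of the continuous problem\<close>

lemma solves_problem_diff:
  assumes "solves_problem V d f u p" "solves_problem V d f' u' p'"
  shows "solves_problem V d (f - f') (u - u') (p - p')"
  using assms unfolding solves_problem_def harmonic_iff
  by (auto simp: subspace_diff[OF subspace_V] subspace_diff[OF subspace_Z] d_diff inner_diff_left algebra_simps)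

lemma solves_problem_add:
  assumes "solves_problem V d f u p" "solves_problem V d f' u' p'"
  shows "solves_problem V d (f + f') (u + u') (p + p')"
  using assms unfolding solves_problem_def harmonic_iff
  by (auto simp: subspace_add[OF subspace_V] subspace_add[OF subspace_Z] d_add inner_add_left)
     (smt (verit))

lemma solves_problem_scale:
  assumes "solves_problem V d f u p"
  shows "solves_problem V d (k *\<^sub>R f) (k *\<^sub>R u) (k *\<^sub>R p)"
  using assms unfolding solves_problem_def harmonic_iff
  by (auto simp: subspace_scale[OF subspace_V] subspace_scale[OF subspace_Z] d_scale)
     (metis distrib_left)

text \<open>Testing with \<open>d u\<close> gives \<open>d u = 0\<close>, because
  \<open>d (d u) = 0\<close> and \<open>p\<close> is orthogonal to the range. Testing with
  \<open>p\<close> then gives \<open>p = 0\<close>. What remains says that \<open>u\<close> is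
  harmonic, hence orthogonal to itself.\<close>

lemma solves_problem_zero:
  assumes "solves_problem V d 0 u p"
  shows "u = 0"
proof -
  have u: "u \<in> V" and p: "p \<in> Z" "\<And>v. v \<in> V \<Longrightarrow> p \<bullet> d v = 0"
    and eq: "\<And>v. v \<in> V \<Longrightarrow> d u \<bullet> v + u \<bullet> d v + p \<bullet> v = 0"
    and orth: "\<And>q. q \<in> harmonic V d \<Longrightarrow> u \<bullet> q = 0"
    using assms by (auto simp: solves_problem_def harmonic_iff)
  have "d u \<in> V" "d (d u) = 0"
    using B_subset_Z u by (auto simp: Z_iff)
  with eq[of "d u"] p(2)[OF u] have du: "d u = 0" by simp
  with eq[of p] p have p0: "p = 0" by (simp add: Z_iff)
  have "u \<in> harmonic V d"
    using u du p0 eq by (simp add: harmonic_iff Z_iff)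
  from orth[OF this] show ?thesis by simp
qed

lemma solution_operator_eq:
  assumes "solves_problem V d f u p"
  shows "solution_operator V d f = u"
  unfolding solution_operator_def
proof (rule the_equality)
  fix u' assume "\<exists>p. solves_problem V d f u' p"
  then show "u' = u"
    using solves_problem_diff[OF _ assms, of f] solves_problem_zero by fastforce
qed (use assms in blast)

text \<open>The solution is T f + T* f with T from \<open>potential_exists\<close>; the Riesz theorem
  supplies T* f.\<close>

lemma solution_exists:
  "\<exists>c. \<forall>f. \<exists>u p. solves_problem V d f u p \<and> norm u \<le> norm f * c"
proof -
  obtain T where "bounded_linear T" and T: "\<And>f. T f \<in> V" "\<And>f. T f \<in> orthogonal_comp Z"
      "\<And>f. d (T f) = orth_proj B f"
    using potential_exists by blast
  interpret T: bounded_linear T by fact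
  obtain c where c: "\<And>f. norm (T f) \<le> norm f * c" "c \<ge> 0"
    using T.nonneg_bounded by blast
  note PB = orth_proj_in[OF closed_B subspace_B] orth_proj_orthogonal[OF closed_B subspace_B]
  note PZ = orth_proj_in[OF closed_Z subspace_Z] orth_proj_orthogonal[OF closed_Z subspace_Z]
  have TZ: "T f \<bullet> z = 0" if "z \<in> Z" for f z
    using T(2)[of f] that by (simp add: orthogonal_comp_def orthogonal_def inner_commute)
  have d_T_d: "d (T (d v)) = d v" if "v \<in> V" for v
  proof -
    have "d v - orth_proj B (d v) \<in> B"
      using that PB(1) by (simp add: subspace_diff[OF subspace_B] in_B)
    from PB(2)[OF this, of "d v"] show ?thesis by (simp add: T(3))
  qed
  \<comment> \<open>Both sides have the same image under \<open>d\<close> and are orthogonal to the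
    kernel, so their difference is in the kernel and orthogonal to itself.\<close>
  have T_d: "T (d v) = v - orth_proj Z v" if "v \<in> V" for v
  proof -
    let ?e = "T (d v) - (v - orth_proj Z v)"
    have zV: "orth_proj Z v \<in> V" "d (orth_proj Z v) = 0" using PZ(1) by (auto simp: Z_iff)
    have "?e \<in> Z"
      using that zV T(1) by (simp add: Z_iff subspace_diff[OF subspace_V] d_diff d_T_d)
    from PZ(2)[OF this, of v] TZ[OF this, of "d v"] have "?e \<bullet> ?e = 0"
      by (simp only: inner_diff_left[of "T (d v)" "v - orth_proj Z v"])
    then show ?thesis by simp
  qed
  have "\<exists>u p. solves_problem V d f u p \<and> norm u \<le> norm f * (c + c)" for f
  proof -
    have "bounded_linear (\<lambda>x. f \<bullet> T x)"
      using bounded_linear_compose[OF bounded_linear_inner_right \<open>bounded_linear T\<close>] by simp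
    \<comment> \<open>This \<open>r\<close> is the adjoint of \<open>T\<close> applied to
      \<open>f\<close>; it inherits the bound \<open>c\<close>.\<close>
    then obtain r where r: "\<And>x. f \<bullet> T x = r \<bullet> x" using Riesz_representation by metis
    have norm_r: "norm r \<le> norm f * c"
    proof -
      have "(norm r)\<^sup>2 = f \<bullet> T r" by (simp add: power2_norm_eq_inner r)
      also have "\<dots> \<le> norm f * norm (T r)" by (rule norm_cauchy_schwarz)
      also have "\<dots> \<le> norm f * (norm r * c)" using c by (intro mult_left_mono) auto
      finally have "norm r * norm r \<le> norm r * (norm f * c)"
        by (simp add: power2_eq_square mult_ac)
      then show ?thesis using c(2)
        by (cases "norm r = 0") (auto simp: mult_le_cancel_left)
    qed
    \<comment> \<open>The part \<open>?e\<close> of \<open>r\<close> orthogonal to \<open>B\<close>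
      projects to 0, so \<open>T ?e\<close> is both in the kernel and orthogonal to it and vanishes.
      Thus \<open>r \<bullet> ?e = f \<bullet> T ?e = 0\<close>, which means
      \<open>?e = 0\<close>.\<close>
    have rB: "r \<in> B"
    proof -
      let ?e = "r - orth_proj B r"
      have "orth_proj B ?e \<bullet> orth_proj B ?e = 0"
        using PB(2)[OF PB(1), of r ?e] PB(2)[OF PB(1), of ?e ?e]
        by (simp only: inner_diff_left[of ?e "orth_proj B ?e"])
      then have "d (T ?e) = 0" by (simp only: T(3)) simp
      then have "T ?e \<in> Z" using T(1) by (simp add: Z_iff)
      then have "T ?e = 0" using TZ by (metis inner_eq_zero_iff)
      then have "r \<bullet> ?e = 0" using r[of ?e] by simp
      with PB(2)[OF PB(1), of r r] have "?e \<bullet> ?e = 0"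
        by (simp only: inner_diff_right[of ?e r]) (simp add: inner_commute)
      then have "r = orth_proj B r" by simp
      then show ?thesis using PB(1)[of r] by simp
    qed
    then have rZ: "r \<in> V" "d r = 0" using B_subset_Z by (auto simp: Z_iff)
    \<comment> \<open>Since \<open>B\<close> lies in \<open>Z\<close>, this is the harmonic
      component of \<open>f\<close>.\<close>
    let ?p = "orth_proj Z f - orth_proj B f"
    have p: "?p \<in> harmonic V d"
      unfolding harmonic_iff
    proof (intro conjI ballI)
      show "?p \<in> Z" using PZ(1) PB(1) B_subset_Z by (intro subspace_diff[OF subspace_Z]) auto
      show "?p \<bullet> d v = 0" if "v \<in> V" for v
        using PZ(2)[of "d v" f] PB(2)[of "d v" f] B_subset_Z in_B[OF that] by (auto simp: inner_diff_left)
    qed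
    have "solves_problem V d f (r + T f) ?p"
      unfolding solves_problem_def
    proof (intro conjI ballI p)
      show "r + T f \<in> V" using rZ T(1) by (simp add: subspace_add[OF subspace_V])
      show "(r + T f) \<bullet> q = 0" if "q \<in> harmonic V d" for q
        using that TZ[of q f] rB by (auto simp: harmonic_iff inner_add_left inner_add_right op_range_def inner_commute)
      \<comment> \<open>The three terms test \<open>v\<close> against \<open>P_B f\<close>,
        \<open>f - P_Z f\<close> and \<open>P_Z f - P_B f\<close>, which add up to \<open>f\<close>;
        the second comes from \<open>T_d\<close> and the self-adjointness of
        \<open>P_Z\<close>.\<close>
      show "d (r + T f) \<bullet> v + (r + T f) \<bullet> d v + ?p \<bullet> v = f \<bullet> v" if "v \<in> V" for v
      proof -
        have 1: "d (r + T f) = orth_proj B f" using rZ T by (simp add: d_add)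
        have 2: "T f \<bullet> d v = 0" using TZ B_subset_Z that by blast
        have 3: "r \<bullet> d v = f \<bullet> v - f \<bullet> orth_proj Z v"
          using r[of "d v"] T_d[OF that] by (simp add: inner_diff_right)
        have 4: "f \<bullet> orth_proj Z v = orth_proj Z f \<bullet> v"
          using PZ(2)[OF PZ(1), of f v] PZ(2)[OF PZ(1), of v f]
          by (simp add: inner_diff_left inner_diff_right inner_commute)
        show ?thesis using 1 2 3 4 by (simp add: inner_add_left inner_diff_left)
      qed
    qed
    moreover have "norm (r + T f) \<le> norm f * (c + c)"
      using norm_triangle_ineq[of r "T f"] norm_r c(1)[of f] by (simp add: distrib_left)
    ultimately show ?thesis by blast
  qed
  then show ?thesis by blast
qed

text \<open>By uniqueness the definite description picks the solution constructed above, so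
  linearity is superposition of solutions and the bound carries over.\<close>

lemma bounded_linear_solution_operator: "bounded_linear (solution_operator V d)"
proof -
  obtain c where c: "\<And>f. \<exists>u p. solves_problem V d f u p \<and> norm u \<le> norm f * c"
    using solution_exists by blast
  then obtain p where sol: "\<And>f. solves_problem V d f (solution_operator V d f) (p f)"
    using solution_operator_eq by metis
  show ?thesis
  proof (rule bounded_linear_intro)
    show "solution_operator V d (a + b) = solution_operator V d a + solution_operator V d b" for a b
      by (rule solution_operator_eq[OF solves_problem_add[OF sol sol]])
    show "solution_operator V d (k *\<^sub>R a) = k *\<^sub>R solution_operator V d a" for k a
      by (rule solution_operator_eq[OF solves_problem_scale[OF sol]])
    show "norm (solution_operator V d f) \<le> norm f * c" for f
      using c[of f] solution_operator_eq by blast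
  qed
qed

text \<open>For data in the range, the preimage orthogonal to the kernel solves the problem with
  \<open>p = 0\<close>: its products with all \<open>d v\<close> vanish because these lie in the
  kernel.\<close>

lemma solution_operator_range:
  assumes "e \<in> B"
  defines "w \<equiv> solution_operator V d e"
  shows "w \<in> V" "d w = e" "\<And>z. z \<in> Z \<Longrightarrow> w \<bullet> z = 0"
proof -
  obtain v0 where v0: "v0 \<in> V" "d v0 = e" using assms(1) by (auto simp: op_range_def)
  define v where "v = v0 - orth_proj Z v0"
  have "orth_proj Z v0 \<in> V" "d (orth_proj Z v0) = 0"
    using orth_proj_in[OF closed_Z subspace_Z] by (auto simp: Z_iff)
  then have v: "v \<in> V" "d v = e"
    using v0 by (simp_all add: v_def d_diff subspace_diff[OF subspace_V])
  have vZ: "v \<bullet> z = 0" if "z \<in> Z" for z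
    using orth_proj_orthogonal[OF closed_Z subspace_Z that] by (simp add: v_def)
  have "solves_problem V d e v 0"
    unfolding solves_problem_def
    using v vZ B_subset_Z subspace_0[OF subspace_Z] by (auto simp: harmonic_iff)
  then have "w = v" unfolding w_def by (rule solution_operator_eq)
  with v vZ show "w \<in> V" "d w = e" "\<And>z. z \<in> Z \<Longrightarrow> w \<bullet> z = 0" by auto
qed

section \<open>The error estimate on a single subspace\<close>

text \<open>The constant depends on the discretization only through the bound \<open>M\<close> of
  the projection, so a common \<open>M\<close> makes the estimate uniform over a family.\<close>

lemma error_estimate:
  assumes U: "subspace U" "U \<subseteq> V" and dU: "d ` U \<subseteq> U"
    and proj: "projection_onto \<pi> U"
    and M: "\<And>w. norm (\<pi> w) \<le> M * norm w" "M \<ge> 0"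
    and commute: "\<And>v. v \<in> V \<Longrightarrow> \<pi> (d v) = d (\<pi> v)"
    and sol: "solves_problem V d f u p"
    and sol_U: "solves_problem U d f uh ph"
  shows "norm (orth_proj B u - orth_proj (op_range U d) uh)
    \<le> (1 + M) * (best_approx_error U (orth_proj B u)
        + onorm (\<lambda>w. solution_operator V d w - \<pi> (solution_operator V d w))
          * (best_approx_error U (d u) + best_approx_error U p))"
proof -
  let ?K = "solution_operator V d" and ?BU = "op_range U d" and ?ZU = "op_ker U d"
  define \<eta> where "\<eta> = onorm (\<lambda>w. ?K w - \<pi> (?K w))"
  have lin: "linear \<pi>" and range: "range \<pi> = U" and idem: "\<And>v. v \<in> U \<Longrightarrow> \<pi> v = v"
    using proj by (auto simp: projection_onto_def)
  have "bounded_linear \<pi>"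
    using lin M(1) by (intro bounded_linear_intro[where K = M])
      (auto simp: linear_add linear_scale mult.commute)
  then have bl: "bounded_linear (\<lambda>w. ?K w - \<pi> (?K w))"
    by (rule bounded_linear_sub[OF bounded_linear_solution_operator
          bounded_linear_compose[OF _ bounded_linear_solution_operator]])
  have \<pi>_B: "\<pi> x \<in> ?BU" if "x \<in> B" for x
    using that commute range by (auto simp: op_range_def)
  \<comment> \<open>This description reduces closedness of \<open>?BU\<close>, needed for projecting
    onto it, to closedness of \<open>B\<close> and continuity of \<open>\<pi>\<close>.\<close>
  have BU_eq: "?BU = B \<inter> {x. \<pi> x = x}"
  proof
    show "?BU \<subseteq> B \<inter> {x. \<pi> x = x}" using U dU idem by (auto simp: op_range_def)
    show "B \<inter> {x. \<pi> x = x} \<subseteq> ?BU" using \<pi>_B by force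
  qed
  have closed_BU: "closed ?BU"
    unfolding BU_eq using closed_B bounded_linear.continuous_on[OF \<open>bounded_linear \<pi>\<close> continuous_on_id]
    by (intro closed_Int closed_Collect_eq) (auto intro: continuous_intros)
  have subspace_BU: "subspace ?BU" using subspace_image[OF U] by (simp add: op_range_def)
  have BU_B: "?BU \<subseteq> B" using BU_eq by blast
  note PB = orth_proj_in[OF closed_B subspace_B] orth_proj_orthogonal[OF closed_B subspace_B]
  note PU = orth_proj_in[OF closed_BU subspace_BU] orth_proj_orthogonal[OF closed_BU subspace_BU]

  define b where "b = orth_proj B u"
  define bh where "bh = orth_proj ?BU uh"
  define e where "e = orth_proj ?BU b - bh"
  define g where "g = (d u + p) - (d uh + ph)"
  have eB: "e \<in> ?BU" unfolding e_def bh_def using PU(1) by (simp add: subspace_diff[OF subspace_BU])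
  then have "e \<in> B" using BU_B by blast
  note w = solution_operator_range[OF this]
  define w where "w = ?K e"
  have du: "d u \<in> Z" "d uh \<in> Z" "p \<in> Z" "ph \<in> Z" "d uh \<in> ?ZU" "ph \<in> ?ZU"
    using sol sol_U U dU B_subset_Z by (auto simp: solves_problem_def harmonic_def op_ker_def op_range_def)
  have gZ: "g \<in> Z"
    unfolding g_def using du by (intro subspace_diff[OF subspace_Z] subspace_add[OF subspace_Z])

  have residual: "(u - uh) \<bullet> d v = - (g \<bullet> v)" if "v \<in> U" for v
  proof -
    have "d u \<bullet> v + u \<bullet> d v + p \<bullet> v = f \<bullet> v" "d uh \<bullet> v + uh \<bullet> d v + ph \<bullet> v = f \<bullet> v"
      using that U sol sol_U by (auto simp: solves_problem_def)
    then show ?thesis by (simp add: g_def inner_add_left inner_diff_left)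
  qed

  \<comment> \<open>As \<open>e\<close> lies in \<open>?BU\<close>, which is contained in
    \<open>B\<close>, every orthogonal projection drops out of a product with \<open>e\<close>,
    leaving \<open>u - uh\<close>.\<close>
  have "e \<bullet> e = (b - bh) \<bullet> e"
    using PU(2)[OF eB, of b] by (simp add: e_def inner_diff_left)
  also have "\<dots> = (u - uh) \<bullet> e"
    using PU(2)[OF eB, of uh] PB(2)[OF \<open>e \<in> B\<close>, of u] by (simp add: b_def bh_def inner_diff_left)
  also have "e = d (\<pi> w)"
    using commute[of w] w idem eB BU_eq by (simp add: w_def)
  also have "(u - uh) \<bullet> d (\<pi> w) = - (g \<bullet> \<pi> w)"
    using residual range by blast
  also have "\<dots> = g \<bullet> (w - \<pi> w)"
    using w(3)[OF gZ] by (simp add: w_def inner_diff_right inner_commute)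
  finally have "(norm e)\<^sup>2 = g \<bullet> (w - \<pi> w)"
    using \<open>e = d (\<pi> w)\<close> by (simp add: power2_norm_eq_inner)
  also have "\<dots> \<le> norm g * norm (w - \<pi> w)" by (rule norm_cauchy_schwarz)
  also have "\<dots> \<le> norm g * (\<eta> * norm e)"
    unfolding w_def \<eta>_def by (intro mult_left_mono onorm[OF bl]) auto
  finally have "norm e * norm e \<le> norm e * (\<eta> * norm g)" by (simp add: power2_eq_square mult_ac)
  moreover have "\<eta> \<ge> 0" unfolding \<eta>_def by (rule onorm_pos_le[OF bl])
  ultimately have norm_e: "norm e \<le> \<eta> * norm g"
    by (cases "norm e = 0") (auto simp: mult_le_cancel_left)

  have "?ZU = Z \<inter> U" using U by (auto simp: op_ker_def)
  then have "subspace ?ZU" using subspace_Z U by (simp add: subspace_inter)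
  \<comment> \<open>For \<open>z\<close> in \<open>?ZU\<close> the left side of
    \<open>residual\<close> vanishes, so \<open>g\<close> is orthogonal to \<open>?ZU\<close>.
    Commutation makes \<open>\<pi>\<close> map \<open>Z\<close> into \<open>?ZU\<close>, which makes
    \<open>\<pi> (d u + p)\<close> an admissible competitor.\<close>
  have "norm g \<le> norm ((d u + p) - \<pi> (d u + p))"
    unfolding g_def
  proof (rule norm_diff_le_of_orthogonal[OF \<open>subspace ?ZU\<close>])
    show "d uh + ph \<in> ?ZU" using du \<open>subspace ?ZU\<close> by (intro subspace_add)
    have "d u + p \<in> Z" using du by (intro subspace_add[OF subspace_Z])
    then show "\<pi> (d u + p) \<in> ?ZU"
      using commute[of "d u + p"] range linear_0[OF lin] by (auto simp: Z_iff op_ker_def)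
    show "(d u + p - (d uh + ph)) \<bullet> z = 0" if "z \<in> ?ZU" for z
      using residual[of z] that by (simp add: op_ker_def g_def)
  qed
  also have "\<dots> = norm ((d u - \<pi> (d u)) + (p - \<pi> p))"
    by (simp add: linear_add[OF lin] algebra_simps)
  also have "\<dots> \<le> (1 + M) * best_approx_error U (d u) + (1 + M) * best_approx_error U p"
    by (intro norm_triangle_mono norm_diff_projection_le[OF proj M])
  finally have norm_g: "norm g \<le> (1 + M) * (best_approx_error U (d u) + best_approx_error U p)"
    by (simp add: distrib_left)

  \<comment> \<open>Here \<open>\<pi> b\<close> is the competitor: \<open>b\<close> is in the range
    of \<open>d\<close>, so commutation puts \<open>\<pi> b\<close> in \<open>?BU\<close>.\<close>
  have "norm (b - orth_proj ?BU b) \<le> norm (b - \<pi> b)"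
    using PU PB(1)[of u] by (intro norm_diff_le_of_orthogonal[OF subspace_BU] \<pi>_B) (auto simp: b_def)
  also have "\<dots> \<le> (1 + M) * best_approx_error U b" by (rule norm_diff_projection_le[OF proj M])
  finally have "norm (b - bh) \<le> (1 + M) * best_approx_error U b + \<eta> * norm g"
    using norm_triangle_ineq[of "b - orth_proj ?BU b" e] norm_e by (simp add: e_def)
  also have "\<dots> \<le> (1 + M) * best_approx_error U b
      + \<eta> * ((1 + M) * (best_approx_error U (d u) + best_approx_error U p))"
    using norm_g \<open>\<eta> \<ge> 0\<close> by (intro add_left_mono mult_left_mono)
  finally show ?thesis by (simp add: b_def bh_def \<eta>_def algebra_simps)
qed

end

theorem theorem3p7:
  fixes V :: "'a::{real_inner, complete_space} set"
    and d :: "'a \<Rightarrow> 'a"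
    and I :: "'h set"
    and Vh :: "'h \<Rightarrow> 'a set"
    and \<pi> :: "'h \<Rightarrow> 'a \<Rightarrow> 'a"
  assumes "diffuse_fredholm_nilpotent V d"
    and "\<And>h. h \<in> I \<Longrightarrow> closed_subspace_graph_norm V d (Vh h)"
    and "\<And>h. h \<in> I \<Longrightarrow> d ` Vh h \<subseteq> Vh h"
    and "\<And>h. h \<in> I \<Longrightarrow> projection_onto (\<pi> h) (Vh h)"
    and "\<exists>M. \<forall>h\<in>I. \<forall>w. norm (\<pi> h w) \<le> M * norm w"
    and "\<And>h v. h \<in> I \<Longrightarrow> v \<in> V \<Longrightarrow> \<pi> h (d v) = d (\<pi> h v)"
  shows "\<exists>C>0. \<forall>f. \<forall>h\<in>I. \<forall>u p uh ph.
    solves_problem V d f u p \<longrightarrow> solves_problem (Vh h) d f uh ph \<longrightarrow>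
    norm (orth_proj (op_range V d) u - orth_proj (op_range (Vh h) d) uh)
      \<le> C * (best_approx_error (Vh h) (orth_proj (op_range V d) u)
             + onorm (\<lambda>w. solution_operator V d w - \<pi> h (solution_operator V d w))
               * (best_approx_error (Vh h) (d u) + best_approx_error (Vh h) p))"
proof -
  interpret diffuse_operator V d by (rule diffuse_operator.intro[OF assms(1)])
  obtain M where M: "\<And>h w. h \<in> I \<Longrightarrow> norm (\<pi> h w) \<le> M * norm w"
    using assms(5) by blast
  \<comment> \<open>The given \<open>M\<close> may be negative, for instance for an empty family;
    its absolute value keeps the constant \<open>1 + \<bar>M\<bar>\<close> positive.\<close>
  have bound: "norm (\<pi> h w) \<le> \<bar>M\<bar> * norm w" if "h \<in> I" for h w
    using M[OF that, of w] by (rule order_trans) (simp add: mult_right_mono)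
  show ?thesis
  proof (intro exI[of _ "1 + \<bar>M\<bar>"] conjI allI ballI impI)
    fix f h u p uh ph
    assume h: "h \<in> I" and sol: "solves_problem V d f u p" "solves_problem (Vh h) d f uh ph"
    have "subspace (Vh h)" "Vh h \<subseteq> V"
      using assms(2)[OF h] by (auto simp: closed_subspace_graph_norm_def)
    from error_estimate[OF this assms(3)[OF h] assms(4)[OF h] bound[OF h] abs_ge_zero
        assms(6)[OF h] sol]
    show "norm (orth_proj (op_range V d) u - orth_proj (op_range (Vh h) d) uh)
      \<le> (1 + \<bar>M\<bar>) * (best_approx_error (Vh h) (orth_proj (op_range V d) u)
             + onorm (\<lambda>w. solution_operator V d w - \<pi> h (solution_operator V d w))
               * (best_approx_error (Vh h) (d u) + best_approx_error (Vh h) p))" .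
  qed simp
qed

end
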